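(* Let $W$ be a standard real-valued Brownian motion on $[0,1]$ and let $\widehat{W}$ be the (unique) quadratic polynomial with a root at $0$ (i.e. $\widehat W_0=0$) and $$\widehat{W}_{1} = W_{1},\qquad \int_{0}^{1}\widehat{W}_{u}\,du = \int_{0}^{1}W_{u}\,du.$$ Then $$\mathbb{E}\left[\int_{0}^{1}W_{u}^{2}\,du\,\Big|\,W_{1},\int_{0}^{1}W_{u}\,du\right] = \int_{0}^{1}\widehat{W}_{u}^{2}\,du + \frac{1}{15}.$$
   Context: $\widehat W$ is a random polynomial $u\mapsto \widehat W_u$ on $[0,1]$ of the form $c_1u+c_2u^2$ with random coefficients determined pathwise by the two stated conditions. Equality of conditional expectations is meant almost surely. *)

theory Defs
  imports "HOL-Probability.Probability" "HOL-Computational_Algebra.Polynomial"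
begin

text \<open>Standard real-valued Brownian motion on \<open>[0, T]\<close>. Values of \<open>W\<close> at times outside
  \<open>{0..T}\<close> are unconstrained. Every path is continuous, so that path integrals are
  random variables on any probability space, complete or not.\<close>

locale brownian_motion_on = prob_space M
  for M :: "'a measure" and T :: real and W :: "real \<Rightarrow> 'a \<Rightarrow> real" +
  assumes random_variable: "t \<in> {0..T} \<Longrightarrow> random_variable borel (W t)"
    and start: "AE \<omega> in M. W 0 \<omega> = 0"
    and continuous_paths: "\<omega> \<in> space M \<Longrightarrow> continuous_on {0..T} (\<lambda>t. W t \<omega>)"
    and independent_increments:
      "mono \<tau> \<Longrightarrow> range \<tau> \<subseteq> {0..T} \<Longrightarrow>
        indep_vars (\<lambda>_. borel) (\<lambda>k \<omega>. W (\<tau> (Suc k)) \<omega> - W (\<tau> k) \<omega>) {..<n}"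
    \<comment> \<open>Only \<open>\<tau> 0, \<dots>, \<tau> n\<close> matter: a finite grid extends to a sequence by repeating its last point.\<close>
    and normal_increments:
      "0 \<le> s \<Longrightarrow> s < u \<Longrightarrow> u \<le> T \<Longrightarrow>
        distributed M lborel (\<lambda>\<omega>. W u \<omega> - W s \<omega>) (normal_density 0 (sqrt (u - s)))"

text \<open>``Quadratic'' means degree at most two: the leading coefficient vanishes for
  exceptional paths.\<close>

definition matches_path :: "(real \<Rightarrow> real) \<Rightarrow> real poly \<Rightarrow> bool" where
  "matches_path w p \<longleftrightarrow> degree p \<le> 2 \<and> poly p 0 = 0 \<and> poly p 1 = w 1 \<and>
     (LBINT u:{0..1}. poly p u) = (LBINT u:{0..1}. w u)"

definition quadratic_of_path :: "(real \<Rightarrow> real) \<Rightarrow> real poly" where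
  "quadratic_of_path w = (THE p. matches_path w p)"

definition sigma_gen2 :: "'a measure \<Rightarrow> ('a \<Rightarrow> real) \<Rightarrow> ('a \<Rightarrow> real) \<Rightarrow> 'a measure" where
  "sigma_gen2 M X Y = vimage_algebra (space M) (\<lambda>\<omega>. (X \<omega>, Y \<omega>)) (borel \<Otimes>\<^sub>M borel)"

end

theory Submission
  imports Defs
begin

text \<open>
  For fixed \<open>u\<close> the value of the matching quadratic is linear in the data:
  with \<open>Y\<close> the area under the path, \<open>What u = (3u^2 - 2u) W 1 + (6u - 6u^2) Y\<close>. This is exactly the
  orthogonal projection of \<open>W u\<close> onto the span of \<open>W 1\<close> and \<open>Y\<close>. Since \<open>(W u, W 1, Y)\<close> is jointly
  Gaussian, the residual \<open>Z u = W u - What u\<close> is therefore independent of \<open>(W 1, Y)\<close>, so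
  conditionally on the data \<open>(W u)^2 = (What u)^2 + 2 (What u) (Z u) + (Z u)^2\<close> has mean
  \<open>(What u)^2 + Var (Z u)\<close>. The variance is \<open>u - 4u^2 + 6u^3 - 3u^4\<close>, whose integral over the unit
  interval is \<open>1/15\<close>; Fubini's theorem exchanges the time integral with the expectation.

  The joint law is handled through characteristic functions. A linear combination of
  \<open>W u\<close>, \<open>W 1\<close> and \<open>Y\<close> is a limit of linear combinations of independent increments over
  the grid \<open>k/n\<close>, which gives its characteristic function as a limit
  (\<open>fourier_value_endpoint_area\<close>). The exponent splits into a part for the residual
  and a part for the data (\<open>fourier_residual\<close>). That such a splitting implies independence is
  derived from the one-dimensional uniqueness theorem of Levy, applied to one variable
  at a time while the others enter as a signed density
  (\<open>indep_var_pair_if_fourier_factors\<close>).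
\<close>

section \<open>Fourier uniqueness for signed densities and independence\<close>

text \<open>
  The hypothesis says that the image under \<open>V\<close> of the signed measure with density \<open>k\<close> has vanishing
  Fourier transform. Its positive and negative parts have equal mass (take \<open>t = 0\<close>). Unless this
  mass is zero, normalising gives two probability densities, and the images have the same characteristic
  function; Levy's theorem makes the images equal.
\<close>

lemma integral_indicator_eq_0_if_fourier_eq_0_real:
  fixes k V :: "'a \<Rightarrow> real"
  assumes k [measurable]: "integrable M k"
    and V [measurable]: "V \<in> borel_measurable M"
    and B [measurable]: "B \<in> sets borel"
    and fourier: "\<And>t. (CLINT \<omega>|M. complex_of_real (k \<omega>) * iexp (t * V \<omega>)) = 0"
  shows "(LINT \<omega>|M. k \<omega> * indicator B (V \<omega>)) = 0"
proof -
  define pos where "pos = (\<lambda>\<omega>. max 0 (k \<omega>))"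
  define neg where "neg = (\<lambda>\<omega>. max 0 (- k \<omega>))"
  have k_eq: "k \<omega> = pos \<omega> - neg \<omega>" for \<omega>
    by (simp add: pos_def neg_def)
  have int: "integrable M pos" "integrable M neg"
    using k by (auto simp: pos_def neg_def)
  note [measurable] = borel_measurable_integrable[OF int(1)] borel_measurable_integrable[OF int(2)]
  have nonneg: "0 \<le> pos \<omega>" "0 \<le> neg \<omega>" for \<omega>
    by (simp_all add: pos_def neg_def)
  define c where "c = integral\<^sup>L M pos"
  have "complex_of_real (LINT \<omega>|M. k \<omega>) = 0"
    using fourier[of 0] by simp
  then have c_neg: "integral\<^sup>L M neg = c"
    using int by (simp add: k_eq c_def)
  show ?thesis
  proof (cases "c = 0")
    case True
    have "AE \<omega> in M. pos \<omega> = 0" "AE \<omega> in M. neg \<omega> = 0"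
      using integral_nonneg_eq_0_iff_AE[OF int(1)] integral_nonneg_eq_0_iff_AE[OF int(2)]
        True nonneg c_neg by (auto simp: c_def)
    then have "AE \<omega> in M. k \<omega> * indicator B (V \<omega>) = 0"
      by eventually_elim (simp add: k_eq)
    then show ?thesis
      by (simp add: integral_eq_zero_AE)
  next
    case False
    then have "c > 0"
      using Bochner_Integration.integral_nonneg[of M pos] nonneg by (auto simp: c_def less_le)
    define N where "N = (\<lambda>h. distr (density M (\<lambda>\<omega>. ennreal (h \<omega> / c))) borel V)"
    have integral_N: "integral\<^sup>L (N h) f = (LINT \<omega>|M. (h \<omega> / c) *\<^sub>R f (V \<omega>))"
      if "h = pos \<or> h = neg" and [measurable]: "f \<in> borel_measurable borel"
      for h and f :: "real \<Rightarrow> 'b::{banach, second_countable_topology}"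
    proof -
      have [measurable]: "h \<in> borel_measurable M" and "0 \<le> h \<omega>" for \<omega>
        using that(1) nonneg by auto
      then show ?thesis
        unfolding N_def using \<open>c > 0\<close> by (simp add: integral_distr integral_density)
    qed
    have real_distr: "real_distribution (N h)" if h: "h = pos \<or> h = neg" for h
    proof -
      have [measurable]: "h \<in> borel_measurable M" and h0: "0 \<le> h \<omega>" for \<omega>
        using that(1) nonneg by auto
      have "prob_space (density M (\<lambda>\<omega>. ennreal (h \<omega> / c)))"
      proof
        have "(\<integral>\<^sup>+\<omega>. ennreal (h \<omega> / c) \<partial>M) = ennreal (LINT \<omega>|M. h \<omega> / c)"
          using int h h0 \<open>c > 0\<close> by (intro nn_integral_eq_integral) auto
        also have "\<dots> = 1"
          using h c_neg \<open>c > 0\<close> by (auto simp: c_def)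
        finally show "emeasure (density M (\<lambda>\<omega>. ennreal (h \<omega> / c)))
            (space (density M (\<lambda>\<omega>. ennreal (h \<omega> / c)))) = 1"
          by (simp add: emeasure_density)
      qed
      then show ?thesis
        unfolding N_def by (intro prob_space.real_distribution_distr) auto
    qed
    have int_iexp: "integrable M (\<lambda>\<omega>. complex_of_real (h \<omega>) * iexp (t * V \<omega>))"
      if "integrable M h" for h t
      by (rule Bochner_Integration.integrable_bound[OF that]) (use that in \<open>auto simp: norm_mult\<close>)
    have "char (N pos) t = char (N neg) t" for t
    proof -
      have "0 = (CLINT \<omega>|M. complex_of_real (pos \<omega>) * iexp (t * V \<omega>))
          - (CLINT \<omega>|M. complex_of_real (neg \<omega>) * iexp (t * V \<omega>))"
        using fourier[of t] int_iexp[OF int(1)] int_iexp[OF int(2)]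
        by (simp add: k_eq left_diff_distrib)
      then show ?thesis
        unfolding char_def by (simp add: integral_N scaleR_conv_of_real)
    qed
    then have "N pos = N neg"
      by (intro Levy_uniqueness real_distr ext) auto
    then have "(LINT \<omega>|M. (pos \<omega> / c) *\<^sub>R indicat_real B (V \<omega>)) = (LINT \<omega>|M. (neg \<omega> / c) *\<^sub>R indicat_real B (V \<omega>))"
      by (subst (1 2) integral_N[symmetric]) auto
    then have eq: "(LINT \<omega>|M. pos \<omega> * indicat_real B (V \<omega>)) = (LINT \<omega>|M. neg \<omega> * indicat_real B (V \<omega>))"
      using \<open>c > 0\<close> by simp
    have int_ind: "integrable M (\<lambda>\<omega>. h \<omega> * indicat_real B (V \<omega>))" if "integrable M h" for h
      by (rule Bochner_Integration.integrable_bound[OF that]) (use that in \<open>auto simp: indicator_def\<close>)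
    show ?thesis
      using int_ind[OF int(1)] int_ind[OF int(2)] eq by (simp add: k_eq left_diff_distrib)
  qed
qed

text \<open>
  Real and imaginary parts of \<open>h\<close> can be treated separately, because conjugating the hypothesis
  at \<open>- t\<close> shows that the conjugate of \<open>h\<close> satisfies it too.
\<close>

lemma integral_indicator_eq_0_if_fourier_eq_0:
  fixes h :: "'a \<Rightarrow> complex" and V :: "'a \<Rightarrow> real"
  assumes h [measurable]: "integrable M h"
    and V [measurable]: "V \<in> borel_measurable M"
    and B [measurable]: "B \<in> sets borel"
    and fourier: "\<And>t. (CLINT \<omega>|M. h \<omega> * iexp (t * V \<omega>)) = 0"
  shows "(CLINT \<omega>|M. h \<omega> * indicator B (V \<omega>)) = 0"
proof -
  have int: "integrable M (\<lambda>\<omega>. h \<omega> * iexp (t * V \<omega>))" for t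
    by (rule Bochner_Integration.integrable_bound[OF h]) (auto simp: norm_mult)
  have cnj_fourier: "(CLINT \<omega>|M. cnj (h \<omega>) * iexp (t * V \<omega>)) = 0" for t
  proof -
    have "(CLINT \<omega>|M. cnj (h \<omega>) * iexp (t * V \<omega>)) = (CLINT \<omega>|M. cnj (h \<omega> * iexp (- t * V \<omega>)))"
      by (intro Bochner_Integration.integral_cong) (simp_all add: exp_cnj)
    also have "\<dots> = cnj (CLINT \<omega>|M. h \<omega> * iexp (- t * V \<omega>))"
      by (rule Bochner_Integration.integral_cnj)
    finally show ?thesis
      using fourier[of "- t"] by simp
  qed
  have cnj_h: "integrable M (\<lambda>\<omega>. cnj (h \<omega>))"
    using h by simp
  note [measurable] = borel_measurable_integrable[OF cnj_h]
  have cnj_int: "integrable M (\<lambda>\<omega>. cnj (h \<omega>) * iexp (t * V \<omega>))" for t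
    by (rule Bochner_Integration.integrable_bound[OF cnj_h]) (auto simp: norm_mult)
  have "(LINT \<omega>|M. Re (h \<omega>) * indicator B (V \<omega>)) = 0"
  proof (rule integral_indicator_eq_0_if_fourier_eq_0_real[OF _ V B])
    fix t
    have "(CLINT \<omega>|M. complex_of_real (Re (h \<omega>)) * iexp (t * V \<omega>))
        = (CLINT \<omega>|M. (h \<omega> * iexp (t * V \<omega>) + cnj (h \<omega>) * iexp (t * V \<omega>)) / 2)"
      by (intro Bochner_Integration.integral_cong)
        (simp_all add: complex_add_cnj flip: distrib_right)
    also have "\<dots> = 0"
      by (simp only: integral_divide_zero Bochner_Integration.integral_add[OF int cnj_int] fourier cnj_fourier) simp
    finally show "(CLINT \<omega>|M. complex_of_real (Re (h \<omega>)) * iexp (t * V \<omega>)) = 0" .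
  qed (use h in simp)
  moreover have "(LINT \<omega>|M. Im (h \<omega>) * indicator B (V \<omega>)) = 0"
  proof (rule integral_indicator_eq_0_if_fourier_eq_0_real[OF _ V B])
    fix t
    have Im_eq: "complex_of_real (Im z) = (z - cnj z) / (2 * \<i>)" for z
      by (simp add: complex_eq_iff)
    have "(CLINT \<omega>|M. complex_of_real (Im (h \<omega>)) * iexp (t * V \<omega>))
        = (CLINT \<omega>|M. (h \<omega> * iexp (t * V \<omega>) - cnj (h \<omega>) * iexp (t * V \<omega>)) / (2 * \<i>))"
      by (intro Bochner_Integration.integral_cong) (simp_all add: Im_eq left_diff_distrib)
    also have "\<dots> = 0"
      by (simp only: integral_divide_zero Bochner_Integration.integral_diff[OF int cnj_int] fourier cnj_fourier) simp
    finally show "(CLINT \<omega>|M. complex_of_real (Im (h \<omega>)) * iexp (t * V \<omega>)) = 0" .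
  qed (use h in simp)
  moreover have int_ind: "integrable M (\<lambda>\<omega>. h \<omega> * indicator B (V \<omega>))"
    by (rule Bochner_Integration.integrable_bound[OF h]) (auto simp: norm_mult indicator_def)
  have "Re (CLINT \<omega>|M. h \<omega> * indicator B (V \<omega>)) = (LINT \<omega>|M. Re (h \<omega>) * indicator B (V \<omega>))"
    unfolding integral_Re[OF int_ind, symmetric]
    by (intro Bochner_Integration.integral_cong) (auto simp: indicator_def)
  moreover
  have "Im (CLINT \<omega>|M. h \<omega> * indicator B (V \<omega>)) = (LINT \<omega>|M. Im (h \<omega>) * indicator B (V \<omega>))"
    unfolding integral_Im[OF int_ind, symmetric]
    by (intro Bochner_Integration.integral_cong) (auto simp: indicator_def)
  ultimately show ?thesis
    by (simp add: complex_eq_iff)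
qed

text \<open>
  On a rectangle the Fourier inversion is done one coordinate at a time: with \<open>b\<close> fixed, the
  factor \<open>iexp (b * X)\<close> is absorbed into the complex density while \<open>Y\<close> is inverted, and then the
  indicator for \<open>Y\<close> is absorbed while \<open>X\<close> is inverted. Rectangles generate the product
  \<open>\<sigma>\<close>-algebra.
\<close>

lemma set_integral_pair_eq_0_if_fourier_eq_0:
  fixes k X Y :: "'a \<Rightarrow> real"
  assumes k [measurable]: "integrable M k"
    and X [measurable]: "X \<in> borel_measurable M" and Y [measurable]: "Y \<in> borel_measurable M"
    and fourier: "\<And>b c. (CLINT \<omega>|M. complex_of_real (k \<omega>) * iexp (b * X \<omega> + c * Y \<omega>)) = 0"
    and B: "B \<in> sets (borel \<Otimes>\<^sub>M borel)"
  shows "(LINT \<omega>:(\<lambda>\<omega>. (X \<omega>, Y \<omega>)) -` B \<inter> space M|M. k \<omega>) = 0"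
proof -
  let ?I = "\<lambda>B. (LINT \<omega>:(\<lambda>\<omega>. (X \<omega>, Y \<omega>)) -` B \<inter> space M|M. k \<omega>)"
  let ?G = "{a \<times> b | a b. a \<in> sets (borel::real measure) \<and> b \<in> sets (borel::real measure)}"
  have ik: "integrable M (\<lambda>\<omega>. complex_of_real (k \<omega>))"
    using k by simp
  have B': "B \<in> sigma_sets UNIV ?G"
    using B by (simp add: sets_pair_measure)
  have meas: "B \<in> sigma_sets UNIV ?G \<Longrightarrow> (\<lambda>\<omega>. (X \<omega>, Y \<omega>)) -` B \<inter> space M \<in> sets M" for B
    by (intro measurable_sets[of _ _ "borel \<Otimes>\<^sub>M borel"]) (auto simp: sets_pair_measure)
  have total: "(LINT \<omega>|M. k \<omega>) = 0"
    using fourier[of 0 0] by simp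
  have Int_st: "Int_stable ?G"
    using Int_stable_pair_measure_generator[of borel borel] by simp
  have "?G \<subseteq> Pow UNIV"
    by simp
  from Int_st this B' show ?thesis
  proof (induction rule: sigma_sets_induct_disjoint[consumes 3,
        case_names basic empty compl union])
    case (basic A)
    then obtain C D where A: "A = C \<times> D" and [measurable]: "C \<in> sets borel" "D \<in> sets borel"
      by auto
    have D0: "(CLINT \<omega>|M. (complex_of_real (k \<omega>) * iexp (b * X \<omega>)) * indicator D (Y \<omega>)) = 0" for b
    proof (rule integral_indicator_eq_0_if_fourier_eq_0)
      show "integrable M (\<lambda>\<omega>. complex_of_real (k \<omega>) * iexp (b * X \<omega>))"
        by (rule Bochner_Integration.integrable_bound[OF ik]) (auto simp: norm_mult)
      show "(CLINT \<omega>|M. complex_of_real (k \<omega>) * iexp (b * X \<omega>) * iexp (t * Y \<omega>)) = 0" for t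
        using fourier[of b t] by (simp add: exp_add[symmetric] distrib_left mult.assoc)
    qed auto
    have "(CLINT \<omega>|M. (complex_of_real (k \<omega>) * indicator D (Y \<omega>)) * indicator C (X \<omega>)) = 0"
    proof (rule integral_indicator_eq_0_if_fourier_eq_0)
      show "integrable M (\<lambda>\<omega>. complex_of_real (k \<omega>) * indicator D (Y \<omega>))"
        by (rule Bochner_Integration.integrable_bound[OF ik]) (auto simp: norm_mult indicator_def)
      show "(CLINT \<omega>|M. complex_of_real (k \<omega>) * indicator D (Y \<omega>) * iexp (t * X \<omega>)) = 0" for t
        using D0[of t] by (simp add: ac_simps)
    qed auto
    then have "complex_of_real (LINT \<omega>|M. k \<omega> * indicator D (Y \<omega>) * indicator C (X \<omega>)) = 0"
      by (subst integral_complex_of_real[symmetric])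
        (simp add: of_real_indicator)
    then have "(LINT \<omega>|M. k \<omega> * indicator D (Y \<omega>) * indicator C (X \<omega>)) = 0"
      by simp
    moreover have "?I A = (LINT \<omega>|M. k \<omega> * indicator D (Y \<omega>) * indicator C (X \<omega>))"
      unfolding set_lebesgue_integral_def A
      by (intro Bochner_Integration.integral_cong) (auto simp: indicator_def)
    ultimately show ?case by simp
  next
    case empty
    show ?case by (simp add: set_lebesgue_integral_def)
  next
    case (compl A)
    have int: "integrable M (\<lambda>\<omega>. indicator S \<omega> *\<^sub>R k \<omega>)" if "S \<in> sets M" for S
      using that k by (rule integrable_mult_indicator)
    have "?I (UNIV - A) + ?I A = (LINT \<omega>|M. k \<omega>)"
      unfolding set_lebesgue_integral_def
        Bochner_Integration.integral_add[OF int int, OF meas meas, OF sigma_sets.Compl[OF compl(1)] compl(1), symmetric]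
      by (intro Bochner_Integration.integral_cong) (auto simp: indicator_def)
    with compl total show ?case by simp
  next
    case (union A)
    have A_sets: "(\<lambda>\<omega>. (X \<omega>, Y \<omega>)) -` A i \<inter> space M \<in> sets M" for i
      using meas union(2) by auto
    have "?I (\<Union>i. A i) = (LINT \<omega>:(\<Union>i. (\<lambda>\<omega>. (X \<omega>, Y \<omega>)) -` A i \<inter> space M)|M. k \<omega>)"
      by (rule arg_cong[where f="\<lambda>S. LINT \<omega>:S|M. k \<omega>"]) auto
    also have "\<dots> = (\<Sum>i. ?I (A i))"
    proof (rule lebesgue_integral_countable_add[OF A_sets])
      show "set_integrable M (\<Union>i. (\<lambda>\<omega>. (X \<omega>, Y \<omega>)) -` A i \<inter> space M) k"
        unfolding set_integrable_def
        by (intro integrable_mult_indicator sets.countable_UN) (use A_sets k in blast)+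
    qed (use union(1) in \<open>auto simp: disjoint_family_on_def\<close>)
    finally show ?case using union by simp
  qed
qed

text \<open>
  Kac's criterion for independence of \<open>Z\<close> and the pair \<open>(X, Y)\<close>: the densities
  \<open>iexp (b * X + c * Y) - \<phi>\<close> and \<open>indicator C Z - p\<close>, each of mean zero, reduce it to the
  uniqueness lemmas for one variable and for a pair. It is stated for real functions \<open>g\<close>
  and \<open>f\<close> of the two because \<^const>\<open>prob_space.indep_var\<close> relates variables of the same type.
\<close>

lemma (in prob_space) indep_var_pair_if_fourier_factors:
  fixes X Y Z :: "'a \<Rightarrow> real"
  assumes X [measurable]: "X \<in> borel_measurable M" and Y [measurable]: "Y \<in> borel_measurable M"
    and Z [measurable]: "Z \<in> borel_measurable M"
    and factors: "\<And>s b c. (CLINT \<omega>|M. iexp (s * Z \<omega> + (b * X \<omega> + c * Y \<omega>)))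
        = (CLINT \<omega>|M. iexp (s * Z \<omega>)) * (CLINT \<omega>|M. iexp (b * X \<omega> + c * Y \<omega>))"
    and g [measurable]: "g \<in> borel_measurable borel"
    and f [measurable]: "f \<in> borel_measurable (borel \<Otimes>\<^sub>M borel)"
  shows "indep_var borel (\<lambda>\<omega>. g (Z \<omega>) :: real) borel (\<lambda>\<omega>. f (X \<omega>, Y \<omega>))"
proof -
  have int_iexp: "integrable M (\<lambda>\<omega>. iexp (f \<omega>))" if "f \<in> borel_measurable M" for f :: "'a \<Rightarrow> real"
    using that by (intro integrable_iexp) auto
  have product: "prob ((Z -` C \<inter> space M) \<inter> ((\<lambda>\<omega>. (X \<omega>, Y \<omega>)) -` B \<inter> space M))
      = prob (Z -` C \<inter> space M) * prob ((\<lambda>\<omega>. (X \<omega>, Y \<omega>)) -` B \<inter> space M)"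
    if C [measurable]: "C \<in> sets borel" and B [measurable]: "B \<in> sets (borel \<Otimes>\<^sub>M borel)" for C B
  proof -
    define p where "p = prob (Z -` C \<inter> space M)"
    have p_eq: "p = (LINT \<omega>|M. indicator C (Z \<omega>))"
    proof -
      have "(LINT \<omega>|M. indicator C (Z \<omega>)) = (LINT \<omega>|M. indicator (Z -` C \<inter> space M) \<omega>)"
        by (intro Bochner_Integration.integral_cong) (auto simp: indicator_def)
      also have "\<dots> = p"
        unfolding p_def by (subst Bochner_Integration.integral_indicator) (simp add: Int_absorb2)
      finally show ?thesis ..
    qed
    have iC: "integrable M (\<lambda>\<omega>. indicat_real C (Z \<omega>))"
      by (rule integrable_const_bound[of _ 1]) (auto simp: indicator_def)
    have fourier: "(CLINT \<omega>|M. complex_of_real (indicator C (Z \<omega>) - p) * iexp (b * X \<omega> + c * Y \<omega>)) = 0" for b c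
    proof -
      let ?T = "\<lambda>\<omega>. b * X \<omega> + c * Y \<omega>"
      define \<phi> where "\<phi> = (CLINT \<omega>|M. iexp (?T \<omega>))"
      \<comment> \<open>Invert in \<open>Z\<close> first, for the complex density of mean zero given by the pair.\<close>
      have "(CLINT \<omega>|M. (iexp (?T \<omega>) - \<phi>) * indicator C (Z \<omega>)) = 0"
      proof (rule integral_indicator_eq_0_if_fourier_eq_0)
        show "integrable M (\<lambda>\<omega>. iexp (?T \<omega>) - \<phi>)"
          by (intro Bochner_Integration.integrable_diff int_iexp) auto
        show "(CLINT \<omega>|M. (iexp (?T \<omega>) - \<phi>) * iexp (t * Z \<omega>)) = 0" for t
        proof -
          have "(CLINT \<omega>|M. (iexp (?T \<omega>) - \<phi>) * iexp (t * Z \<omega>))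
              = (CLINT \<omega>|M. iexp (t * Z \<omega> + ?T \<omega>) - \<phi> * iexp (t * Z \<omega>))"
            by (intro Bochner_Integration.integral_cong) (auto simp: exp_add[symmetric] algebra_simps)
          also have "\<dots> = (CLINT \<omega>|M. iexp (t * Z \<omega> + ?T \<omega>)) - \<phi> * (CLINT \<omega>|M. iexp (t * Z \<omega>))"
            by (subst Bochner_Integration.integral_diff)
              (auto intro!: int_iexp integrable_mult_right simp del: of_real_add of_real_mult)
          finally show ?thesis
            unfolding factors \<phi>_def by simp
        qed
      qed auto
      moreover have i1: "integrable M (\<lambda>\<omega>. iexp (?T \<omega>) * indicator C (Z \<omega>))"
        by (rule Bochner_Integration.integrable_bound[OF int_iexp[of ?T]]) (auto simp: norm_mult indicator_def)
      moreover have i2: "integrable M (\<lambda>\<omega>. \<phi> * indicator C (Z \<omega>))"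
        by (intro integrable_mult_right integrable_const_bound[of _ 1]) (auto simp: indicator_def)
      ultimately have "(CLINT \<omega>|M. iexp (?T \<omega>) * indicator C (Z \<omega>)) = (CLINT \<omega>|M. \<phi> * indicator C (Z \<omega>))"
        by (simp only: left_diff_distrib Bochner_Integration.integral_diff) simp
      also have "\<dots> = \<phi> * (CLINT \<omega>|M. complex_of_real (indicator C (Z \<omega>)))"
        by (simp add: of_real_indicator)
      also have "\<dots> = \<phi> * p"
        by (simp only: integral_complex_of_real p_eq)
      finally have 1: "(CLINT \<omega>|M. iexp (?T \<omega>) * indicator C (Z \<omega>)) = \<phi> * p" .
      have "(CLINT \<omega>|M. complex_of_real (indicator C (Z \<omega>) - p) * iexp (?T \<omega>))
          = (CLINT \<omega>|M. iexp (?T \<omega>) * indicator C (Z \<omega>) - p * iexp (?T \<omega>))"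
        by (intro Bochner_Integration.integral_cong) (auto simp: of_real_indicator algebra_simps)
      also have "\<dots> = 0"
        by (subst Bochner_Integration.integral_diff)
          (use i1 in \<open>auto simp: 1 \<phi>_def simp del: of_real_add of_real_mult intro!: int_iexp\<close>)
      finally show ?thesis .
    qed
    let ?S = "(\<lambda>\<omega>. (X \<omega>, Y \<omega>)) -` B \<inter> space M"
    \<comment> \<open>Then invert in the pair, for the density \<open>indicator C Z - p\<close>.\<close>
    have [measurable]: "?S \<in> sets M" "Z -` C \<inter> space M \<in> sets M" by measurable
    have "0 = (LINT \<omega>:?S|M. indicator C (Z \<omega>) - p)"
      by (rule set_integral_pair_eq_0_if_fourier_eq_0[symmetric]) (use iC fourier in auto)
    also have "\<dots> = (LINT \<omega>|M. indicator ((Z -` C \<inter> space M) \<inter> ?S) \<omega> - p * indicator ?S \<omega>)"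
      unfolding set_lebesgue_integral_def
      by (intro Bochner_Integration.integral_cong) (auto simp: indicator_def)
    also have "\<dots> = prob ((Z -` C \<inter> space M) \<inter> ?S) - p * prob ?S"
      by (subst Bochner_Integration.integral_diff) (auto simp: emeasure_eq_measure)
    finally show ?thesis
      by (simp add: p_def)
  qed
  show ?thesis
    unfolding indep_var_distribution_eq
  proof (intro conjI pair_measure_eqI)
    fix A B :: "real set"
    assume "A \<in> sets (distr M borel (\<lambda>\<omega>. g (Z \<omega>)))" "B \<in> sets (distr M borel (\<lambda>\<omega>. f (X \<omega>, Y \<omega>)))"
    then have [measurable]: "A \<in> sets borel" "B \<in> sets borel"
      by auto
    have sets: "g -` A \<in> sets borel" "f -` B \<in> sets (borel \<Otimes>\<^sub>M borel)"
      using measurable_sets[OF g, of A] measurable_sets[OF f, of B] by (auto simp: space_pair_measure)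
    have "(\<lambda>\<omega>. (g (Z \<omega>), f (X \<omega>, Y \<omega>))) -` (A \<times> B) \<inter> space M
        = (Z -` (g -` A) \<inter> space M) \<inter> ((\<lambda>\<omega>. (X \<omega>, Y \<omega>)) -` (f -` B) \<inter> space M)"
      by auto
    then show "emeasure (distr M borel (\<lambda>\<omega>. g (Z \<omega>))) A * emeasure (distr M borel (\<lambda>\<omega>. f (X \<omega>, Y \<omega>))) B
        = emeasure (distr M (borel \<Otimes>\<^sub>M borel) (\<lambda>\<omega>. (g (Z \<omega>), f (X \<omega>, Y \<omega>)))) (A \<times> B)"
      using product[OF sets]
      by (simp add: emeasure_distr emeasure_eq_measure ennreal_mult vimage_def)
  qed (auto intro!: finite_measure.sigma_finite_measure finite_measure_distr)
qed

section \<open>Characteristic functions and moments of normal variables\<close>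

lemma (in prob_space) fourier_normal:
  assumes Z: "distributed M lborel Z (normal_density 0 \<sigma>)" and "\<sigma> > 0"
  shows "(CLINT \<omega>|M. iexp (t * Z \<omega>)) = complex_of_real (exp (- (\<sigma>\<^sup>2 * t\<^sup>2) / 2))"
proof -
  have std: "distributed M lborel (\<lambda>\<omega>. Z \<omega> / \<sigma>) std_normal_density"
    using Z normal_standard_normal_convert[OF \<open>\<sigma> > 0\<close>, of Z 0] by simp
  have [measurable]: "(\<lambda>\<omega>. Z \<omega> / \<sigma>) \<in> borel_measurable M"
    using distributed_measurable[OF std] by simp
  have "(CLINT \<omega>|M. iexp (t * Z \<omega>)) = (CLINT \<omega>|M. iexp ((\<sigma> * t) * (Z \<omega> / \<sigma>)))"
    using \<open>\<sigma> > 0\<close> by simp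
  also have "\<dots> = (CLINT x|distr M lborel (\<lambda>\<omega>. Z \<omega> / \<sigma>). iexp ((\<sigma> * t) * x))"
    by (subst integral_distr) auto
  also have "\<dots> = char std_normal_distribution (\<sigma> * t)"
    unfolding distributed_distr_eq_density[OF std] char_def ..
  finally show ?thesis
    by (simp add: char_std_normal_distribution power_mult_distrib)
qed

lemma (in prob_space) distributed_normal_if_fourier:
  assumes [measurable]: "Z \<in> borel_measurable M" and "\<sigma> > 0"
    and fourier: "\<And>t. (CLINT \<omega>|M. iexp (t * Z \<omega>)) = complex_of_real (exp (- (\<sigma>\<^sup>2 * t\<^sup>2) / 2))"
  shows "distributed M lborel Z (normal_density 0 \<sigma>)"
proof -
  let ?N = "density lborel (normal_density 0 \<sigma>)"
  interpret N: prob_space ?N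
    by (rule prob_space_normal_density[OF \<open>\<sigma> > 0\<close>])
  have real_N: "real_distribution ?N"
    unfolding real_distribution_def real_distribution_axioms_def
    using N.prob_space_axioms by simp
  have id: "distributed ?N lborel (\<lambda>x. x) (normal_density 0 \<sigma>)"
    unfolding distributed_def by (auto simp: distr_id2)
  have "char (distr M borel Z) t = char ?N t" for t
  proof -
    have "char (distr M borel Z) t = (CLINT \<omega>|M. iexp (t * Z \<omega>))"
      unfolding char_def by (subst integral_distr) auto
    also have "\<dots> = char ?N t"
      unfolding fourier N.fourier_normal[OF id \<open>\<sigma> > 0\<close>, symmetric] char_def ..
    finally show ?thesis .
  qed
  then have "char (distr M borel Z) = char ?N" ..
  then have "distr M borel Z = ?N"
    by (intro Levy_uniqueness real_N real_distribution_distr) auto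
  moreover have "distr M lborel Z = distr M borel Z"
    by (rule distr_cong) auto
  ultimately show ?thesis
    unfolding distributed_def by auto
qed

lemma (in prob_space) normal_second_moment:
  assumes Z: "distributed M lborel Z (normal_density 0 \<sigma>)" and "\<sigma> > 0"
  shows "integrable M (\<lambda>\<omega>. (Z \<omega>)\<^sup>2)" "expectation Z = 0" "expectation (\<lambda>\<omega>. (Z \<omega>)\<^sup>2) = \<sigma>\<^sup>2"
proof -
  show "integrable M (\<lambda>\<omega>. (Z \<omega>)\<^sup>2)"
    using integrable_normal_moment[OF \<open>\<sigma> > 0\<close>, of 0 2] distributed_integrable[OF Z, of "\<lambda>x. x\<^sup>2"]
    by simp
  show E: "expectation Z = 0"
    by (rule normal_distributed_expectation[OF \<open>\<sigma> > 0\<close> Z])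
  show "expectation (\<lambda>\<omega>. (Z \<omega>)\<^sup>2) = \<sigma>\<^sup>2"
    using normal_distributed_variance[OF \<open>\<sigma> > 0\<close> Z] by (simp add: E)
qed

section \<open>Grid approximation of continuous paths\<close>

lemma floor_grid_tendsto:
  "(\<lambda>n. of_int \<lfloor>u * real (Suc n)\<rfloor> / real (Suc n)) \<longlonglongrightarrow> (u::real)"
proof (rule tendsto_sandwich[OF always_eventually always_eventually])
  show "\<forall>n. u - 1 / real (Suc n) \<le> of_int \<lfloor>u * real (Suc n)\<rfloor> / real (Suc n)"
  proof
    fix n
    have "u * real (Suc n) - 1 \<le> of_int \<lfloor>u * real (Suc n)\<rfloor>"
      by linarith
    then have "(u * real (Suc n) - 1) / real (Suc n) \<le> of_int \<lfloor>u * real (Suc n)\<rfloor> / real (Suc n)"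
      by (rule divide_right_mono) simp
    then show "u - 1 / real (Suc n) \<le> of_int \<lfloor>u * real (Suc n)\<rfloor> / real (Suc n)"
      by (simp add: diff_divide_distrib del: of_nat_Suc)
  qed
  show "\<forall>n. of_int \<lfloor>u * real (Suc n)\<rfloor> / real (Suc n) \<le> u"
    by (simp add: divide_le_eq del: of_nat_Suc)
  show "(\<lambda>n. u - 1 / real (Suc n)) \<longlonglongrightarrow> u"
    using tendsto_diff[OF tendsto_const[of u] LIMSEQ_inverse_real_of_nat]
    by (simp add: inverse_eq_divide)
qed auto

text \<open>
  Joint measurability, as required by Fubini's theorem: the process is the pointwise limit of its
  values at the grid points to the left of \<open>u\<close>, and each of these is a countable case distinction.
\<close>

lemma borel_measurable_continuous_process:
  fixes f :: "real \<Rightarrow> 'a \<Rightarrow> real"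
  assumes meas: "\<And>u. f u \<in> borel_measurable M"
    and cont: "\<And>\<omega>. \<omega> \<in> space M \<Longrightarrow> continuous_on UNIV (\<lambda>u. f u \<omega>)"
  shows "(\<lambda>(u, \<omega>). f u \<omega>) \<in> borel_measurable (lborel \<Otimes>\<^sub>M M)"
proof (rule borel_measurable_LIMSEQ_metric)
  show "(\<lambda>(u, \<omega>). f (of_int \<lfloor>u * real (Suc n)\<rfloor> / real (Suc n)) \<omega>) \<in> borel_measurable (lborel \<Otimes>\<^sub>M M)" for n
    unfolding split_beta
  proof (rule measurable_compose_countable'[where g="\<lambda>x. \<lfloor>fst x * real (Suc n)\<rfloor>" and I=UNIV
        and f="\<lambda>i x. f (of_int i / real (Suc n)) (snd x)"])
    show "(\<lambda>x. f (of_int i / real (Suc n)) (snd x)) \<in> borel_measurable (lborel \<Otimes>\<^sub>M M)" for i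
      by (rule measurable_compose[OF measurable_snd meas])
  qed auto
  show "(\<lambda>n. (\<lambda>(u, \<omega>). f (of_int \<lfloor>u * real (Suc n)\<rfloor> / real (Suc n)) \<omega>) x) \<longlonglongrightarrow> (\<lambda>(u, \<omega>). f u \<omega>) x"
    if x_space: "x \<in> space (lborel \<Otimes>\<^sub>M M)" for x
  proof -
    obtain u \<omega> where x: "x = (u, \<omega>)" and \<omega>: "\<omega> \<in> space M"
      using x_space by (cases x) (auto simp: space_pair_measure)
    have "isCont (\<lambda>u. f u \<omega>) u"
      using cont[OF \<omega>] by (simp add: continuous_on_eq_continuous_at)
    from isCont_tendsto_compose[OF this floor_grid_tendsto]
    show ?thesis by (simp add: x)
  qed
qed

text \<open>
  The mean value theorem for the antiderivative turns each piece of the integral into a value of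
  \<open>f\<close> in that grid cell, which uniform continuity compares with the value at the right end.
\<close>

lemma riemann_sum_tendsto:
  fixes f :: "real \<Rightarrow> real"
  assumes f: "continuous_on {0..1} f"
  shows "(\<lambda>n. (\<Sum>k<Suc n. f (real (Suc k) / real (Suc n))) / real (Suc n)) \<longlonglongrightarrow> (LBINT u:{0..1}. f u)"
proof (rule LIMSEQ_I)
  fix e :: real assume "e > 0"
  have "uniformly_continuous_on {0..1} f"
    by (rule compact_uniformly_continuous[OF f]) simp
  then obtain d where "d > 0"
    and d: "\<And>x y. x \<in> {0..1} \<Longrightarrow> y \<in> {0..1} \<Longrightarrow> dist y x < d \<Longrightarrow> dist (f y) (f x) < e / 2"
    using \<open>e > 0\<close> unfolding uniformly_continuous_on_def by (metis half_gt_zero)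
  obtain N where N: "inverse (real (Suc N)) < d"
    using reals_Archimedean[OF \<open>d > 0\<close>] by auto
  define F where "F = (\<lambda>u. integral {0..u} f)"
  have F: "(F has_real_derivative f x) (at x within {0..1})" if "x \<in> {0..1}" for x
    unfolding F_def has_real_derivative_iff_has_vector_derivative
    by (rule integral_has_vector_derivative[OF f that])
  have int_F: "(LBINT u:{0..1}. f u) = F 1 - F 0"
    unfolding F_def using set_borel_integral_eq_integral(2)[OF borel_integrable_atLeastAtMost'[OF f]]
    by simp
  show "\<exists>no. \<forall>n\<ge>no. norm ((\<Sum>k<Suc n. f (real (Suc k) / real (Suc n))) / real (Suc n) - (LBINT u:{0..1}. f u)) < e"
  proof (intro exI allI impI)
    fix n assume "n \<ge> N"
    define x where "x = (\<lambda>k. real k / real (Suc n))"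
    have diff: "x (Suc k) - x k = 1 / real (Suc n)" for k
      by (simp add: x_def diff_divide_distrib[symmetric])
    have small: "1 / real (Suc n) < d"
      using N \<open>n \<ge> N\<close> by (smt (verit) Suc_le_mono frac_le inverse_eq_divide of_nat_0_less_iff of_nat_le_iff zero_less_Suc)
    have step: "\<bar>f (x (Suc k)) / real (Suc n) - (F (x (Suc k)) - F (x k))\<bar> \<le> (e / 2) / real (Suc n)"
      if "k < Suc n" for k
    proof -
      have le: "0 \<le> x k" "x k < x (Suc k)" "x (Suc k) \<le> 1"
        using that by (auto simp: x_def field_simps)
      have "\<exists>z\<in>{x k<..<x (Suc k)}. F (x (Suc k)) - F (x k) = f z * (x (Suc k) - x k)"
      proof (rule mvt_simple[OF le(2)])
        fix z assume "x k \<le> z" "z \<le> x (Suc k)"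
        then have "(F has_real_derivative f z) (at z within {x k..x (Suc k)})"
          using le by (intro DERIV_subset[OF F]) auto
        then show "(F has_derivative (*) (f z)) (at z within {x k..x (Suc k)})"
          by (simp add: has_field_derivative_def)
      qed
      then obtain z where z: "x k < z" "z < x (Suc k)"
        and "F (x (Suc k)) - F (x k) = f z * (x (Suc k) - x k)"
        by auto
      then have "f (x (Suc k)) / real (Suc n) - (F (x (Suc k)) - F (x k)) = (f (x (Suc k)) - f z) / real (Suc n)"
        by (simp only: diff) (simp add: diff_divide_distrib)
      moreover have "dist (f (x (Suc k))) (f z) < e / 2"
        using z le small diff[of k] by (intro d) (auto simp: dist_real_def)
      then have "\<bar>f (x (Suc k)) - f z\<bar> / real (Suc n) \<le> (e / 2) / real (Suc n)"
        by (intro divide_right_mono) (auto simp: dist_real_def)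
      ultimately show ?thesis
        by (simp only: abs_divide abs_of_nat)
    qed
    have telescope: "(\<Sum>k<Suc n. F (x (Suc k)) - F (x k)) = F 1 - F 0"
      by (subst sum_lessThan_telescope) (simp add: x_def)
    have "(\<Sum>k<Suc n. f (x (Suc k))) / real (Suc n) - (LBINT u:{0..1}. f u)
        = (\<Sum>k<Suc n. f (x (Suc k)) / real (Suc n) - (F (x (Suc k)) - F (x k)))"
      by (subst sum_subtractf) (simp only: telescope int_F sum_divide_distrib)
    also have "\<bar>\<dots>\<bar> \<le> (\<Sum>k<Suc n. (e / 2) / real (Suc n))"
      by (intro order_trans[OF sum_abs] sum_mono step) simp
    also have "\<dots> = e / 2"
      by (simp del: of_nat_Suc sum.lessThan_Suc)
    finally show "norm ((\<Sum>k<Suc n. f (real (Suc k) / real (Suc n))) / real (Suc n) - (LBINT u:{0..1}. f u)) < e"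
      using \<open>e > 0\<close> by (simp add: x_def)
  qed
qed

text \<open>
  Summation by parts: for \<open>n = N\<close> it writes a Riemann sum of a path as a linear combination of
  increments.
\<close>

lemma sum_by_parts_linear:
  fixes w :: "nat \<Rightarrow> real"
  shows "(\<Sum>k<n. (N - real k) * (w (Suc k) - w k)) = (N - real n) * w n + (\<Sum>k<n. w (Suc k)) - N * w 0"
  by (induction n) (auto simp: algebra_simps)

lemma sum_linear: "(\<Sum>k<n. p + r * (1 - real k * x)) = (p + r) * real n - r * x * real n * (real n - 1) / 2"
  for p r x :: real
  by (induction n) (auto simp: field_simps)

lemma sum_linear_squared:
  fixes b c x :: real
  shows "(\<Sum>k<n. (b + c * (1 - real k * x))\<^sup>2) = (b + c)\<^sup>2 * real n - (b + c) * c * x * real n * (real n - 1)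
    + c\<^sup>2 * x\<^sup>2 * real n * (real n - 1) * (2 * real n - 1) / 6"
  by (induction n) (auto simp: field_simps power2_eq_square)

section \<open>Joint characteristic function of value, endpoint and area\<close>

locale unit_brownian_motion = brownian_motion_on M 1 W for M :: "'a measure" and W
begin

lemma fourier_increment_sum:
  "(CLINT \<omega>|M. iexp (\<Sum>k<Suc n. h k * (W (real (Suc k) / real (Suc n)) \<omega> - W (real k / real (Suc n)) \<omega>)))
    = complex_of_real (exp (- ((\<Sum>k<Suc n. (h k)\<^sup>2) / real (Suc n)) / 2))"
proof -
  define \<tau> where "\<tau> = (\<lambda>k. min 1 (real k / real (Suc n)))"
  have \<tau>: "\<tau> k = real k / real (Suc n)" if "k \<le> Suc n" for k
    using that by (simp add: \<tau>_def)
  have "mono \<tau>"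
    unfolding mono_def \<tau>_def by (intro allI impI min.mono divide_right_mono) auto
  have "range \<tau> \<subseteq> {0..1}"
    by (auto simp: \<tau>_def)
  have rv [measurable]: "W (\<tau> k) \<in> borel_measurable M" for k
    by (rule random_variable) (use \<open>range \<tau> \<subseteq> {0..1}\<close> in blast)
  let ?D = "\<lambda>k \<omega>. h k * (W (\<tau> (Suc k)) \<omega> - W (\<tau> k) \<omega>)"
  have "indep_vars (\<lambda>_. borel) ?D {..<Suc n}"
    by (rule indep_vars_compose2[where Y="\<lambda>k x. h k * x",
          OF independent_increments[OF \<open>mono \<tau>\<close> \<open>range \<tau> \<subseteq> {0..1}\<close>, of "Suc n"]]) auto
  from char_distr_sum[OF this, of 1]
  have "(CLINT \<omega>|M. iexp (\<Sum>k<Suc n. ?D k \<omega>)) = (\<Prod>k<Suc n. char (distr M borel (?D k)) 1)"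
    by (simp add: char_def integral_distr del: sum.lessThan_Suc prod.lessThan_Suc of_real_sum)
  also have "\<dots> = (\<Prod>k<Suc n. complex_of_real (exp (- ((h k)\<^sup>2 / real (Suc n)) / 2)))"
  proof (rule prod.cong[OF refl])
    fix k assume "k \<in> {..<Suc n}"
    then have k: "k < Suc n" by simp
    have diff: "\<tau> (Suc k) - \<tau> k = 1 / real (Suc n)"
      using k by (simp add: \<tau> diff_divide_distrib[symmetric])
    have "distributed M lborel (\<lambda>\<omega>. W (\<tau> (Suc k)) \<omega> - W (\<tau> k) \<omega>) (normal_density 0 (sqrt (\<tau> (Suc k) - \<tau> k)))"
      using k by (intro normal_increments) (auto simp: \<tau> divide_strict_right_mono)
    from fourier_normal[OF this, of "h k"]
    show "char (distr M borel (?D k)) 1 = complex_of_real (exp (- ((h k)\<^sup>2 / real (Suc n)) / 2))"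
      unfolding diff by (simp add: char_def integral_distr)
  qed
  also have "\<dots> = complex_of_real (exp (- ((\<Sum>k<Suc n. (h k)\<^sup>2) / real (Suc n)) / 2))"
    by (simp only: of_real_prod[symmetric] exp_sum[OF finite_lessThan, symmetric] sum_divide_distrib[symmetric] sum_negf)
  also have "(CLINT \<omega>|M. iexp (\<Sum>k<Suc n. ?D k \<omega>)) = (CLINT \<omega>|M. iexp (\<Sum>k<Suc n. h k * (W (real (Suc k) / real (Suc n)) \<omega> - W (real k / real (Suc n)) \<omega>)))"
    by (intro Bochner_Integration.integral_cong arg_cong[where f=iexp] sum.cong refl) (simp add: \<tau>)
  finally show ?thesis .
qed

abbreviation area :: "'a \<Rightarrow> real" where "area \<omega> \<equiv> LBINT u:{0..1}. W u \<omega>"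

lemma borel_measurable_path_integral:
  assumes g: "continuous_on UNIV g"
  shows "(\<lambda>\<omega>. LBINT u:{0..1}. (g (W u \<omega>) :: real)) \<in> borel_measurable M"
proof (rule borel_measurable_LIMSEQ_metric)
  have [measurable]: "g \<in> borel_measurable borel"
    by (rule borel_measurable_continuous_onI[OF g])
  have W: "W (real (Suc k) / real (Suc n)) \<in> borel_measurable M" if "k < Suc n" for k n
    using that by (intro random_variable) auto
  show "(\<lambda>\<omega>. (\<Sum>k<Suc n. g (W (real (Suc k) / real (Suc n)) \<omega>)) / real (Suc n)) \<in> borel_measurable M" for n
    by (intro borel_measurable_divide borel_measurable_sum measurable_compose[OF W, of _ _ g]) auto
  show "(\<lambda>n. (\<Sum>k<Suc n. g (W (real (Suc k) / real (Suc n)) \<omega>)) / real (Suc n))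
      \<longlonglongrightarrow> (LBINT u:{0..1}. g (W u \<omega>))" if "\<omega> \<in> space M" for \<omega>
    by (rule riemann_sum_tendsto)
      (use continuous_on_compose2[OF g continuous_paths[OF that]] in simp)
qed

text \<open>
  The variance of \<open>a * W u + b * W 1 + c * area\<close>, that is, the integral over \<open>t\<close> in the unit
  interval of the square of \<open>a * indicator {..u} t + b + c * (1 - t)\<close>.
\<close>

definition covariance_form :: "real \<Rightarrow> real \<Rightarrow> real \<Rightarrow> real \<Rightarrow> real" where
  "covariance_form u a b c = a\<^sup>2 * u + b\<^sup>2 + c\<^sup>2 / 3 + 2 * a * b * u + b * c + 2 * a * c * (u - u\<^sup>2 / 2)"

text \<open>
  On the grid with \<open>n + 1\<close> cells, replace \<open>u\<close> by the grid point to its left and the area by the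
  right Riemann sum. Their combination, for the path shifted to start at zero, is \<open>S n\<close>,
  a sum of independent normal increments with coefficients \<open>h n k\<close>, so its characteristic function is explicit. Continuity of the paths makes
  \<open>S n\<close> converge almost surely, and the variances of \<open>S n\<close> converge to the covariance form.
\<close>

lemma fourier_value_endpoint_area:
  assumes u: "u \<in> {0..1}"
  shows "(CLINT \<omega>|M. iexp (a * W u \<omega> + b * W 1 \<omega> + c * area \<omega>))
    = complex_of_real (exp (- covariance_form u a b c / 2))"
proof -
  define m where "m = (\<lambda>n. nat \<lfloor>u * real (Suc n)\<rfloor>)"
  have m_real: "real (m n) = of_int \<lfloor>u * real (Suc n)\<rfloor>" for n
    using u by (simp add: m_def)
  have m_le: "m n \<le> Suc n" for n
  proof -
    have "u * real (Suc n) \<le> real (Suc n)"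
      using u mult_right_mono[of u 1 "real (Suc n)"] by simp
    then have "real (m n) \<le> real (Suc n)"
      unfolding m_real by linarith
    then show ?thesis by simp
  qed
  have grid: "real (m n) / real (Suc n) \<in> {0..1}" for n
    using m_le[of n] by (simp add: divide_le_eq del: of_nat_Suc)
  have \<mu>: "(\<lambda>n. real (m n) / real (Suc n)) \<longlonglongrightarrow> u"
    unfolding m_real by (rule floor_grid_tendsto)
  define h where "h = (\<lambda>n k. (if k < m n then a else 0) + b + c * (1 - real k * (1 / real (Suc n))))"
  define S where "S = (\<lambda>n \<omega>. \<Sum>k<Suc n. h n k * (W (real (Suc k) / real (Suc n)) \<omega> - W (real k / real (Suc n)) \<omega>))"
  have restrict: "(\<Sum>k<Suc n. if k < m n then f k else 0) = (\<Sum>k<m n. f k)" for n and f :: "nat \<Rightarrow> real"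
  proof -
    have "{..<Suc n} \<inter> {k. k < m n} = {..<m n}"
      using m_le[of n] by auto
    then show ?thesis
      by (simp add: sum.If_cases del: sum.lessThan_Suc)
  qed
  have S_eq: "S n \<omega> = a * (W (real (m n) / real (Suc n)) \<omega> - W 0 \<omega>) + b * (W 1 \<omega> - W 0 \<omega>)
      + c * ((\<Sum>k<Suc n. W (real (Suc k) / real (Suc n)) \<omega>) / real (Suc n) - W 0 \<omega>)" for n \<omega>
  proof -
    define w where "w = (\<lambda>k. W (real k / real (Suc n)) \<omega>)"
    have ends: "w 0 = W 0 \<omega>" "w (Suc n) = W 1 \<omega>"
      by (simp_all add: w_def)
    have "S n \<omega> = (\<Sum>k<Suc n. (if k < m n then a * (w (Suc k) - w k) else 0) + b * (w (Suc k) - w k)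
        + c / real (Suc n) * ((real (Suc n) - real k) * (w (Suc k) - w k)))"
      unfolding S_def h_def w_def
      by (intro sum.cong refl) (auto simp: field_simps)
    also have "\<dots> = a * (\<Sum>k<m n. w (Suc k) - w k) + b * (\<Sum>k<Suc n. w (Suc k) - w k)
        + c / real (Suc n) * (\<Sum>k<Suc n. (real (Suc n) - real k) * (w (Suc k) - w k))"
      unfolding sum.distrib restrict sum_distrib_left[symmetric] ..
    also have "\<dots> = a * (w (m n) - w 0) + b * (w (Suc n) - w 0)
        + c / real (Suc n) * ((\<Sum>k<Suc n. w (Suc k)) - real (Suc n) * w 0)"
      unfolding sum_lessThan_telescope sum_by_parts_linear by simp
    also have "\<dots> = a * (w (m n) - w 0) + b * (w (Suc n) - w 0)
        + c * ((\<Sum>k<Suc n. w (Suc k)) / real (Suc n) - w 0)"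
      by (simp add: field_simps del: sum.lessThan_Suc)
    finally show ?thesis
      unfolding ends by (simp only: w_def)
  qed
  have S_meas: "S n \<in> borel_measurable M" for n
    unfolding S_def
    by (intro borel_measurable_sum borel_measurable_times borel_measurable_diff random_variable) auto
  \<comment> \<open>Increments only see \<open>W - W 0\<close>, so the limit uses the almost sure start at zero.\<close>
  have S_lim: "(\<lambda>n. S n \<omega>) \<longlonglongrightarrow> a * W u \<omega> + b * W 1 \<omega> + c * area \<omega>"
    if \<omega>: "\<omega> \<in> space M" and W0: "W 0 \<omega> = 0" for \<omega>
  proof -
    have "(\<lambda>n. W (real (m n) / real (Suc n)) \<omega>) \<longlonglongrightarrow> W u \<omega>"
      by (intro continuous_on_tendsto_compose[OF continuous_paths[OF \<omega>] \<mu> u] always_eventually allI grid)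
    then show ?thesis
      unfolding S_eq W0 diff_zero
      by (intro tendsto_add tendsto_mult tendsto_const riemann_sum_tendsto continuous_paths \<omega>)
  qed
  have area_meas: "area \<in> borel_measurable M"
    using borel_measurable_path_integral[of "\<lambda>x. x"] by simp
  have [measurable]: "W u \<in> borel_measurable M" "W 1 \<in> borel_measurable M"
    using u by (auto intro!: random_variable)
  have lim1: "(\<lambda>n. CLINT \<omega>|M. iexp (S n \<omega>)) \<longlonglongrightarrow> (CLINT \<omega>|M. iexp (a * W u \<omega> + b * W 1 \<omega> + c * area \<omega>))"
  proof (rule integral_dominated_convergence[where w="\<lambda>_. 1"])
    show "AE \<omega> in M. (\<lambda>n. iexp (S n \<omega>)) \<longlonglongrightarrow> iexp (a * W u \<omega> + b * W 1 \<omega> + c * area \<omega>)"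
      using start AE_space
    proof eventually_elim
      case (elim \<omega>)
      show ?case
        by (rule isCont_tendsto_compose[OF isCont_iexp S_lim]) (use elim in auto)
    qed
  qed (use S_meas area_meas in auto)
  have variance_eq: "((a\<^sup>2 + 2 * a * b + 2 * a * c) * \<mu> - 2 * a * c * (1 / N) * \<mu> * (\<mu> - 1) / 2
      + ((b + c)\<^sup>2 * N - (b + c) * c * (1 / N) * N * (N - 1)
        + c\<^sup>2 * (1 / N)\<^sup>2 * N * (N - 1) * (2 * N - 1) / 6)) / N
      = (a\<^sup>2 + 2 * a * b + 2 * a * c) * (\<mu> / N) - a * c * (\<mu> / N) * (\<mu> / N - inverse N)
        + ((b + c)\<^sup>2 - (b + c) * c * (1 - inverse N) + c\<^sup>2 * (1 - inverse N) * (2 - inverse N) / 6)"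
    if "N > 0" for N \<mu> :: real
    using that by (simp add: field_simps power2_eq_square)
  have square: "((if k < l then a else 0) + b + c * t)\<^sup>2
      = (if k < l then a\<^sup>2 + 2 * a * b + 2 * a * c * t else 0) + (b + c * t)\<^sup>2" for k l :: nat and t
    by (simp add: power2_eq_square algebra_simps)
  have "(\<Sum>k<Suc n. (h n k)\<^sup>2) = (\<Sum>k<m n. (a\<^sup>2 + 2 * a * b) + 2 * a * c * (1 - real k * (1 / real (Suc n))))
      + (\<Sum>k<Suc n. (b + c * (1 - real k * (1 / real (Suc n))))\<^sup>2)" for n
    unfolding restrict[symmetric] sum.distrib[symmetric] h_def square ..
  then have V: "(\<Sum>k<Suc n. (h n k)\<^sup>2) / real (Suc n)
      = (a\<^sup>2 + 2 * a * b + 2 * a * c) * (real (m n) / real (Suc n))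
        - a * c * (real (m n) / real (Suc n)) * (real (m n) / real (Suc n) - inverse (real (Suc n)))
        + ((b + c)\<^sup>2 - (b + c) * c * (1 - inverse (real (Suc n)))
        + c\<^sup>2 * (1 - inverse (real (Suc n))) * (2 - inverse (real (Suc n))) / 6)" for n
    unfolding sum_linear sum_linear_squared by (simp only: variance_eq of_nat_0_less_iff zero_less_Suc)
  have "(\<lambda>n. (\<Sum>k<Suc n. (h n k)\<^sup>2) / real (Suc n)) \<longlonglongrightarrow>
      (a\<^sup>2 + 2 * a * b + 2 * a * c) * u - a * c * u * (u - 0)
      + ((b + c)\<^sup>2 - (b + c) * c * (1 - 0) + c\<^sup>2 * (1 - 0) * (2 - 0) / 6)"
    unfolding V by (intro tendsto_intros \<mu> LIMSEQ_inverse_real_of_nat) auto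
  also have "(a\<^sup>2 + 2 * a * b + 2 * a * c) * u - a * c * u * (u - 0)
      + ((b + c)\<^sup>2 - (b + c) * c * (1 - 0) + c\<^sup>2 * (1 - 0) * (2 - 0) / 6) = covariance_form u a b c"
    by (simp add: covariance_form_def power2_eq_square field_simps)
  finally have "(\<lambda>n. complex_of_real (exp (- ((\<Sum>k<Suc n. (h n k)\<^sup>2) / real (Suc n)) / 2)))
      \<longlonglongrightarrow> complex_of_real (exp (- covariance_form u a b c / 2))"
    by (intro tendsto_of_real tendsto_exp tendsto_divide tendsto_minus) auto
  then have "(\<lambda>n. CLINT \<omega>|M. iexp (S n \<omega>)) \<longlonglongrightarrow> complex_of_real (exp (- covariance_form u a b c / 2))"
    unfolding S_def fourier_increment_sum .
  with lim1 show ?thesis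
    by (rule LIMSEQ_unique)
qed

end

section \<open>The matching quadratic and its coefficient weights\<close>

lemma unit_interval_integral_eq:
  fixes f :: "real \<Rightarrow> real"
  assumes "\<And>x. DERIV F x :> f x" "\<And>x. isCont f x"
  shows "(LBINT u:{0..1}. f u) = F 1 - F 0"
  using integral_FTC_Icc_real[of 0 1 F f] assms
  by (simp add: set_lebesgue_integral_def mult.commute)

lemma poly_unit_interval_integral: "(LBINT u:{0..1}. poly [:0, a, b:] u) = a / 2 + b / 3"
  for a b :: real
  by (subst unit_interval_integral_eq[where F="\<lambda>u. a * u\<^sup>2 / 2 + b * u ^ 3 / 3"])
    (auto intro!: derivative_eq_intros simp: power2_eq_square algebra_simps)

text \<open>
  The two conditions \<open>a + b = w 1\<close> and \<open>a / 2 + b / 3 = I\<close>, where \<open>I\<close> is the integral of \<open>w\<close>, on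
  \<open>[:0, a, b:]\<close> form a regular linear system with solution \<open>a = 6 * I - 2 * w 1\<close> and
  \<open>b = 3 * w 1 - 6 * I\<close>.
\<close>

lemma matches_path_iff:
  "matches_path w p \<longleftrightarrow> p = [:0, 6 * (LBINT u:{0..1}. w u) - 2 * w 1, 3 * w 1 - 6 * (LBINT u:{0..1}. w u):]"
proof
  assume m: "matches_path w p"
  define a b where "a = coeff p 1" and "b = coeff p 2"
  have "coeff p n = coeff [:0, a, b:] n" for n
  proof (cases "n > 2")
    case True
    then show ?thesis
      using m coeff_eq_0[of p n] coeff_eq_0[of "[:0, a, b:]" n] by (simp add: matches_path_def)
  next
    case False
    then have "n = 0 \<or> n = 1 \<or> n = 2" by auto
    then show ?thesis
      using m by (auto simp: matches_path_def poly_0_coeff_0 a_def b_def numeral_2_eq_2)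
  qed
  then have p: "p = [:0, a, b:]"
    by (intro poly_eqI)
  have "a + b = w 1" "a / 2 + b / 3 = (LBINT u:{0..1}. w u)"
    using m unfolding matches_path_def p poly_unit_interval_integral by auto
  then show "p = [:0, 6 * (LBINT u:{0..1}. w u) - 2 * w 1, 3 * w 1 - 6 * (LBINT u:{0..1}. w u):]"
    unfolding p by auto
next
  assume p: "p = [:0, 6 * (LBINT u:{0..1}. w u) - 2 * w 1, 3 * w 1 - 6 * (LBINT u:{0..1}. w u):]"
  show "matches_path w p"
    unfolding matches_path_def p poly_unit_interval_integral by (simp add: field_simps)
qed

definition endpoint_weight :: "real \<Rightarrow> real" where "endpoint_weight u = 3 * u\<^sup>2 - 2 * u"
definition area_weight :: "real \<Rightarrow> real" where "area_weight u = 6 * u - 6 * u\<^sup>2"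
text \<open>
  The variance of \<open>W u\<close>, which is \<open>u\<close>, minus that of its projection; see
  \<open>covariance_form_residual\<close>.
\<close>

definition residual_variance :: "real \<Rightarrow> real" where
  "residual_variance u = u - 4 * u\<^sup>2 + 6 * u ^ 3 - 3 * u ^ 4"

lemma residual_variance_pos:
  assumes "0 < u" "u < 1"
  shows "residual_variance u > 0"
proof -
  have "residual_variance u = u * (1 - u) * (3 * (u - 1 / 2)\<^sup>2 + 1 / 4)"
    by (simp add: residual_variance_def power2_eq_square power3_eq_cube power4_eq_xxxx field_simps)
  moreover have "3 * (u - 1 / 2)\<^sup>2 + 1 / 4 > 0"
    by (rule add_nonneg_pos) auto
  ultimately show ?thesis
    using assms by simp
qed

text \<open>
  With \<open>s = 0\<close> this is the integral of the squared quadratic in terms of the data; the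
  coefficient of \<open>s\<close> is the constant \<open>1/15\<close> of the theorem.
\<close>

lemma weights_integral:
  "(LBINT u:{0..1}. (endpoint_weight u)\<^sup>2 * p + 2 * endpoint_weight u * area_weight u * q
      + (area_weight u)\<^sup>2 * r + residual_variance u * s)
    = 2 / 15 * p - q / 5 + 6 / 5 * r + s / 15"
proof -
  let ?F = "\<lambda>u. (9 * u ^ 5 / 5 - 3 * u ^ 4 + 4 * u ^ 3 / 3) * p
    + 2 * (15 * u ^ 4 / 2 - 18 * u ^ 5 / 5 - 4 * u ^ 3) * q
    + 36 * (u ^ 3 / 3 - u ^ 4 / 2 + u ^ 5 / 5) * r
    + (u\<^sup>2 / 2 - 4 * u ^ 3 / 3 + 3 * u ^ 4 / 2 - 3 * u ^ 5 / 5) * s"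
  show ?thesis
    by (subst unit_interval_integral_eq[where F="?F"])
      (auto intro!: derivative_eq_intros continuous_intros
        simp: endpoint_weight_def area_weight_def residual_variance_def
          power2_eq_square power3_eq_cube power4_eq_xxxx eval_nat_numeral field_simps)
qed

lemma poly_matching_eq:
  "poly [:0, 6 * y - 2 * x, 3 * x - 6 * y:] u = endpoint_weight u * x + area_weight u * y"
  by (simp add: endpoint_weight_def area_weight_def power2_eq_square algebra_simps)

section \<open>The residual is independent of endpoint and area\<close>

context unit_brownian_motion
begin

lemma W_measurable [measurable]: "u \<in> {0..1} \<Longrightarrow> W u \<in> borel_measurable M"
  by (rule random_variable)

lemma W_1_measurable [measurable]: "W 1 \<in> borel_measurable M"
  by (rule random_variable) simp

lemma area_measurable [measurable]: "area \<in> borel_measurable M"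
  using borel_measurable_path_integral[of "\<lambda>x. x"] by simp

lemma distributed_value:
  assumes u: "0 < u" "u \<le> 1"
  shows "distributed M lborel (W u) (normal_density 0 (sqrt u))"
proof (rule distributed_normal_if_fourier)
  show "(CLINT \<omega>|M. iexp (t * W u \<omega>)) = complex_of_real (exp (- ((sqrt u)\<^sup>2 * t\<^sup>2) / 2))" for t
    using fourier_value_endpoint_area[of u t 0 0] u
    by (simp add: covariance_form_def mult.commute)
qed (use u in auto)

lemma distributed_area: "distributed M lborel area (normal_density 0 (sqrt (1 / 3)))"
proof (rule distributed_normal_if_fourier)
  show "(CLINT \<omega>|M. iexp (t * area \<omega>)) = complex_of_real (exp (- ((sqrt (1 / 3))\<^sup>2 * t\<^sup>2) / 2))" for t
    using fourier_value_endpoint_area[of 0 0 0 t] by (simp add: covariance_form_def real_sqrt_divide power_divide)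
qed auto

text \<open>
  At \<open>u = 0\<close> the law is degenerate and has no density, hence the separate case.
\<close>

lemma second_moment_value:
  assumes u: "u \<in> {0..1}"
  shows "integrable M (\<lambda>\<omega>. (W u \<omega>)\<^sup>2)" "expectation (\<lambda>\<omega>. (W u \<omega>)\<^sup>2) = u"
proof -
  have "integrable M (\<lambda>\<omega>. (W u \<omega>)\<^sup>2) \<and> expectation (\<lambda>\<omega>. (W u \<omega>)\<^sup>2) = u"
  proof (cases "u = 0")
    case True
    have 0: "AE \<omega> in M. (W 0 \<omega>)\<^sup>2 = 0"
      using start by eventually_elim simp
    have "integrable M (\<lambda>\<omega>. (W 0 \<omega>)\<^sup>2)"
      by (rule integrable_cong_AE_imp[where g="\<lambda>_. 0"]) (use 0 in auto)
    with 0 True show ?thesis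
      by (simp add: integral_eq_zero_AE)
  next
    case False
    with u have "0 < u" "u \<le> 1" by auto
    then show ?thesis
      using normal_second_moment[OF distributed_value] by simp
  qed
  then show "integrable M (\<lambda>\<omega>. (W u \<omega>)\<^sup>2)" "expectation (\<lambda>\<omega>. (W u \<omega>)\<^sup>2) = u"
    by auto
qed

lemma integrable_endpoint_area_square:
  "integrable M (\<lambda>\<omega>. (W 1 \<omega>)\<^sup>2)" "integrable M (\<lambda>\<omega>. W 1 \<omega> * area \<omega>)" "integrable M (\<lambda>\<omega>. (area \<omega>)\<^sup>2)"
  "integrable M (W 1)" "integrable M area"
proof -
  show W: "integrable M (\<lambda>\<omega>. (W 1 \<omega>)\<^sup>2)"
    by (rule second_moment_value) simp
  show area: "integrable M (\<lambda>\<omega>. (area \<omega>)\<^sup>2)"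
    by (rule normal_second_moment[OF distributed_area]) simp
  show "integrable M (W 1)" "integrable M area"
    using square_integrable_imp_integrable[OF _ W] square_integrable_imp_integrable[OF _ area] by simp_all
  show "integrable M (\<lambda>\<omega>. W 1 \<omega> * area \<omega>)"
  proof (rule Bochner_Integration.integrable_bound[OF Bochner_Integration.integrable_add[OF W area]])
    have "\<bar>x * y\<bar> \<le> x\<^sup>2 + y\<^sup>2" for x y :: real
    proof -
      have "2 * (\<bar>x\<bar> * \<bar>y\<bar>) \<le> x\<^sup>2 + y\<^sup>2"
        using sum_squares_bound[of "\<bar>x\<bar>" "\<bar>y\<bar>"] by (simp add: mult.assoc)
      moreover have "0 \<le> \<bar>x\<bar> * \<bar>y\<bar>"
        by simp
      ultimately show ?thesis
        unfolding abs_mult by linarith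
    qed
    then show "AE \<omega> in M. norm (W 1 \<omega> * area \<omega>) \<le> norm ((W 1 \<omega>)\<^sup>2 + (area \<omega>)\<^sup>2)"
      by simp
  qed auto
qed

definition residual :: "real \<Rightarrow> 'a \<Rightarrow> real" where
  "residual u \<omega> = W u \<omega> - (endpoint_weight u * W 1 \<omega> + area_weight u * area \<omega>)"

lemma residual_measurable [measurable]: "u \<in> {0..1} \<Longrightarrow> residual u \<in> borel_measurable M"
  unfolding residual_def by measurable

text \<open>
  Absence of a mixed term between \<open>s\<close> and \<open>(b, c)\<close>: the residual is uncorrelated with \<open>W 1\<close> and
  with the area. This is where the choice of the two weights enters.
\<close>

lemma covariance_form_residual:
  "covariance_form u s (b - s * endpoint_weight u) (c - s * area_weight u)
    = residual_variance u * s\<^sup>2 + covariance_form u 0 b c"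
  by (simp add: covariance_form_def endpoint_weight_def area_weight_def residual_variance_def
      power2_eq_square power3_eq_cube power4_eq_xxxx field_simps)

lemma fourier_residual:
  assumes u: "u \<in> {0..1}"
  shows "(CLINT \<omega>|M. iexp (s * residual u \<omega> + (b * W 1 \<omega> + c * area \<omega>)))
    = complex_of_real (exp (- (residual_variance u * s\<^sup>2) / 2)) * (CLINT \<omega>|M. iexp (b * W 1 \<omega> + c * area \<omega>))"
proof -
  have "s * residual u \<omega> + (b * W 1 \<omega> + c * area \<omega>)
      = s * W u \<omega> + (b - s * endpoint_weight u) * W 1 \<omega> + (c - s * area_weight u) * area \<omega>" for \<omega>
    by (simp add: residual_def algebra_simps)
  then have "(CLINT \<omega>|M. iexp (s * residual u \<omega> + (b * W 1 \<omega> + c * area \<omega>)))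
      = complex_of_real (exp (- (residual_variance u * s\<^sup>2 + covariance_form u 0 b c) / 2))"
    by (simp only: fourier_value_endpoint_area[OF u] covariance_form_residual)
  also have "\<dots> = complex_of_real (exp (- (residual_variance u * s\<^sup>2) / 2))
      * complex_of_real (exp (- covariance_form u 0 b c / 2))"
    by (simp only: of_real_mult[symmetric] exp_add[symmetric] add_divide_distrib minus_add_distrib)
  also have "complex_of_real (exp (- covariance_form u 0 b c / 2)) = (CLINT \<omega>|M. iexp (b * W 1 \<omega> + c * area \<omega>))"
    using fourier_value_endpoint_area[OF u, of 0 b c] by simp
  finally show ?thesis .
qed

lemma
  assumes u: "0 < u" "u < 1"
  shows residual_second_moment: "integrable M (\<lambda>\<omega>. (residual u \<omega>)\<^sup>2)" "expectation (residual u) = 0"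
      "expectation (\<lambda>\<omega>. (residual u \<omega>)\<^sup>2) = residual_variance u"
    and residual_indep: "g \<in> borel_measurable borel \<Longrightarrow> f \<in> borel_measurable (borel \<Otimes>\<^sub>M borel) \<Longrightarrow>
      indep_var borel (\<lambda>\<omega>. g (residual u \<omega>) :: real) borel (\<lambda>\<omega>. f (W 1 \<omega>, area \<omega>))"
proof -
  have u01: "u \<in> {0..1}" using u by simp
  have F: "(CLINT \<omega>|M. iexp (s * residual u \<omega>)) = complex_of_real (exp (- (residual_variance u * s\<^sup>2) / 2))" for s
    using fourier_residual[OF u01, of s 0 0] by (simp add: prob_space)
  have "distributed M lborel (residual u) (normal_density 0 (sqrt (residual_variance u)))"
    by (rule distributed_normal_if_fourier)
      (use residual_variance_pos[OF u] u01 in \<open>simp_all only: F real_sqrt_gt_0_iff real_sqrt_pow2 less_imp_le residual_measurable\<close>)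
  from normal_second_moment[OF this] residual_variance_pos[OF u]
  show "integrable M (\<lambda>\<omega>. (residual u \<omega>)\<^sup>2)" "expectation (residual u) = 0"
    "expectation (\<lambda>\<omega>. (residual u \<omega>)\<^sup>2) = residual_variance u"
    by simp_all
  show "indep_var borel (\<lambda>\<omega>. g (residual u \<omega>) :: real) borel (\<lambda>\<omega>. f (W 1 \<omega>, area \<omega>))"
    if "g \<in> borel_measurable borel" "f \<in> borel_measurable (borel \<Otimes>\<^sub>M borel)"
    by (rule indep_var_pair_if_fourier_factors[OF W_1_measurable area_measurable residual_measurable[OF u01] _ that])
      (simp only: fourier_residual[OF u01] F)
qed

section \<open>The conditional expectation\<close>

text \<open>
  Expand \<open>(W u)\<^sup>2\<close> around the projection. The event depends on the data only, so by independence
  the mixed term contributes the mean zero of the residual and the square its variance.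
\<close>

lemma set_integral_value_square:
  assumes u: "0 < u" "u < 1" and B [measurable]: "B \<in> sets (borel \<Otimes>\<^sub>M borel)"
  defines "A \<equiv> (\<lambda>\<omega>. (W 1 \<omega>, area \<omega>)) -` B \<inter> space M"
  shows "(LINT \<omega>:A|M. (W u \<omega>)\<^sup>2) = (endpoint_weight u)\<^sup>2 * (LINT \<omega>:A|M. (W 1 \<omega>)\<^sup>2)
    + 2 * endpoint_weight u * area_weight u * (LINT \<omega>:A|M. W 1 \<omega> * area \<omega>)
    + (area_weight u)\<^sup>2 * (LINT \<omega>:A|M. (area \<omega>)\<^sup>2) + residual_variance u * prob A"
proof -
  have [measurable]: "u \<in> {0..1}" using u by simp
  have [measurable]: "A \<in> sets M"
    unfolding A_def by measurable
  note moments = residual_second_moment[OF u]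
  note endpoint = integrable_endpoint_area_square
  have int_ind: "integrable M (\<lambda>\<omega>. indicator A \<omega> * f \<omega>)" if "integrable M f" for f :: "'a \<Rightarrow> real"
    using integrable_mult_indicator[OF \<open>A \<in> sets M\<close> that] by simp
  have int_residual: "integrable M (residual u)"
    by (rule square_integrable_imp_integrable[OF _ moments(1)]) simp
  \<comment> \<open>The projection restricted to the event, as a function of the data.\<close>
  define fit where "fit = (\<lambda>x. indicator B x * (endpoint_weight u * fst x + area_weight u * snd x))"
  have [measurable]: "fit \<in> borel_measurable (borel \<Otimes>\<^sub>M borel)"
    unfolding fit_def by measurable
  have fit_A: "fit (W 1 \<omega>, area \<omega>) = indicator A \<omega> * (endpoint_weight u * W 1 \<omega> + area_weight u * area \<omega>)"
    if "\<omega> \<in> space M" for \<omega>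
    using that by (simp add: fit_def A_def indicator_def)
  have int_fit: "integrable M (\<lambda>\<omega>. fit (W 1 \<omega>, area \<omega>))"
    by (subst Bochner_Integration.integrable_cong[OF refl fit_A], assumption)
      (intro int_ind Bochner_Integration.integrable_add integrable_mult_right endpoint)
  have indep1: "indep_var borel (residual u) borel (\<lambda>\<omega>. fit (W 1 \<omega>, area \<omega>))"
    using residual_indep[OF u, of "\<lambda>x. x" fit] by simp
  have cross: "integrable M (\<lambda>\<omega>. residual u \<omega> * fit (W 1 \<omega>, area \<omega>))" "(LINT \<omega>|M. residual u \<omega> * fit (W 1 \<omega>, area \<omega>)) = 0"
    using indep_var_integrable[OF indep1 int_residual int_fit]
      indep_var_lebesgue_integral[OF indep1 int_residual int_fit] moments(2) by simp_all
  have int_B: "integrable M (\<lambda>\<omega>. indicat_real B (W 1 \<omega>, area \<omega>))"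
    by (rule integrable_const_bound[of _ 1]) (auto simp: indicator_def)
  have indep2: "indep_var borel (\<lambda>\<omega>. (residual u \<omega>)\<^sup>2) borel (\<lambda>\<omega>. indicat_real B (W 1 \<omega>, area \<omega>))"
    using residual_indep[OF u, of "\<lambda>x. x\<^sup>2" "indicator B"] by simp
  have "(LINT \<omega>|M. indicat_real B (W 1 \<omega>, area \<omega>)) = (LINT \<omega>|M. indicator A \<omega>)"
    by (intro Bochner_Integration.integral_cong) (auto simp: A_def indicator_def)
  also have "\<dots> = prob A"
    by (subst Bochner_Integration.integral_indicator) (simp add: A_def Int_absorb2)
  finally have square: "integrable M (\<lambda>\<omega>. (residual u \<omega>)\<^sup>2 * indicat_real B (W 1 \<omega>, area \<omega>))"
      "(LINT \<omega>|M. (residual u \<omega>)\<^sup>2 * indicat_real B (W 1 \<omega>, area \<omega>)) = residual_variance u * prob A"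
    using indep_var_integrable[OF indep2 moments(1) int_B]
      indep_var_lebesgue_integral[OF indep2 moments(1) int_B] moments(3) by simp_all
  have "(LINT \<omega>:A|M. (W u \<omega>)\<^sup>2) = (LINT \<omega>|M. (endpoint_weight u)\<^sup>2 * (indicator A \<omega> * (W 1 \<omega>)\<^sup>2)
      + 2 * endpoint_weight u * area_weight u * (indicator A \<omega> * (W 1 \<omega> * area \<omega>))
      + (area_weight u)\<^sup>2 * (indicator A \<omega> * (area \<omega>)\<^sup>2)
      + 2 * (residual u \<omega> * fit (W 1 \<omega>, area \<omega>)) + (residual u \<omega>)\<^sup>2 * indicat_real B (W 1 \<omega>, area \<omega>))"
    unfolding set_lebesgue_integral_def[of M]
  proof (intro Bochner_Integration.integral_cong refl)
    fix \<omega> assume "\<omega> \<in> space M"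
    then have "indicat_real B (W 1 \<omega>, area \<omega>) = indicator A \<omega>"
      by (simp add: A_def indicator_def)
    moreover have "W u \<omega> = (endpoint_weight u * W 1 \<omega> + area_weight u * area \<omega>) + residual u \<omega>"
      by (simp add: residual_def)
    ultimately show "indicat_real A \<omega> *\<^sub>R (W u \<omega>)\<^sup>2 = (endpoint_weight u)\<^sup>2 * (indicator A \<omega> * (W 1 \<omega>)\<^sup>2)
      + 2 * endpoint_weight u * area_weight u * (indicator A \<omega> * (W 1 \<omega> * area \<omega>))
      + (area_weight u)\<^sup>2 * (indicator A \<omega> * (area \<omega>)\<^sup>2)
      + 2 * (residual u \<omega> * fit (W 1 \<omega>, area \<omega>)) + (residual u \<omega>)\<^sup>2 * indicat_real B (W 1 \<omega>, area \<omega>)"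
      unfolding fit_A[OF \<open>\<omega> \<in> space M\<close>] by (simp add: power2_eq_square algebra_simps)
  qed
  also have "\<dots> = (endpoint_weight u)\<^sup>2 * (LINT \<omega>:A|M. (W 1 \<omega>)\<^sup>2)
      + 2 * endpoint_weight u * area_weight u * (LINT \<omega>:A|M. W 1 \<omega> * area \<omega>)
      + (area_weight u)\<^sup>2 * (LINT \<omega>:A|M. (area \<omega>)\<^sup>2)
      + 2 * 0 + residual_variance u * prob A"
    by (simp add: set_lebesgue_integral_def[of M] int_ind endpoint cross square)
  finally show ?thesis by simp
qed

text \<open>
  Clamping time to the unit interval makes the process continuous on the whole line, so that it is
  jointly measurable; the indicator removes the extension again.
\<close>

lemma integrable_product_square:
  "integrable (lborel \<Otimes>\<^sub>M M) (\<lambda>(u, \<omega>). indicator {0..1} u * (W (max 0 (min 1 u)) \<omega>)\<^sup>2)"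
proof -
  interpret pair_sigma_finite lborel M ..
  have "(\<lambda>(u, \<omega>). W (max 0 (min 1 u)) \<omega>) \<in> borel_measurable (lborel \<Otimes>\<^sub>M M)"
  proof (rule borel_measurable_continuous_process)
    show "continuous_on UNIV (\<lambda>u. W (max 0 (min 1 u)) \<omega>)" if "\<omega> \<in> space M" for \<omega>
      by (rule continuous_on_compose2[OF continuous_paths[OF that]]) (auto intro!: continuous_intros)
  qed (auto intro!: random_variable)
  then have [measurable]: "(\<lambda>x. W (max 0 (min 1 (fst x))) (snd x)) \<in> borel_measurable (lborel \<Otimes>\<^sub>M M)"
    by (simp add: split_beta)
  show ?thesis
  proof (rule Fubini_integrable)
    show "(\<lambda>(u, \<omega>). indicator {0..1} u * (W (max 0 (min 1 u)) \<omega>)\<^sup>2) \<in> borel_measurable (lborel \<Otimes>\<^sub>M M)"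
      unfolding split_beta by measurable
    have second_moment: "(LINT \<omega>|M. norm (indicator {0..1} u * (W (max 0 (min 1 u)) \<omega>)\<^sup>2)) = indicator {0..1} u * u" for u
      using second_moment_value(2)[of u] by (cases "u \<in> {0..1}") auto
    show "integrable lborel (\<lambda>u. LINT \<omega>|M. norm (case (u, \<omega>) of (u, \<omega>) \<Rightarrow> indicator {0..1} u * (W (max 0 (min 1 u)) \<omega>)\<^sup>2))"
      unfolding prod.case second_moment
      using borel_integrable_atLeastAtMost'[of 0 1 "\<lambda>u::real. u"] by (simp add: set_integrable_def)
    have "integrable M (\<lambda>\<omega>. indicator {0..1} u * (W (max 0 (min 1 u)) \<omega>)\<^sup>2)" for u
      using second_moment_value(1)[of u] by (cases "u \<in> {0..1}") auto
    then show "AE u in lborel. integrable M (\<lambda>\<omega>. case (u, \<omega>) of (u, \<omega>) \<Rightarrow> indicator {0..1} u * (W (max 0 (min 1 u)) \<omega>)\<^sup>2)"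
      by simp
  qed
qed

lemma path_square_integral_eq:
  "(LBINT u:{0..1}. (W u \<omega>)\<^sup>2) = (LINT u|lborel. indicator {0..1} u * (W (max 0 (min 1 u)) \<omega>)\<^sup>2)"
  unfolding set_lebesgue_integral_def
  by (intro Bochner_Integration.integral_cong) (auto simp: indicator_def)

lemma integrable_path_square_integral: "integrable M (\<lambda>\<omega>. LBINT u:{0..1}. (W u \<omega>)\<^sup>2)"
proof -
  interpret pair_sigma_finite lborel M ..
  show ?thesis
    unfolding path_square_integral_eq by (rule integrable_snd[OF integrable_product_square])
qed

text \<open>
  Fubini's theorem reduces this to the events at fixed times; the times 0 and 1, where the residual
  is degenerate, form a null set.
\<close>

lemma set_integral_path_square_integral:
  assumes B [measurable]: "B \<in> sets (borel \<Otimes>\<^sub>M borel)"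
  defines "A \<equiv> (\<lambda>\<omega>. (W 1 \<omega>, area \<omega>)) -` B \<inter> space M"
  shows "(LINT \<omega>:A|M. LBINT u:{0..1}. (W u \<omega>)\<^sup>2)
    = 2 / 15 * (LINT \<omega>:A|M. (W 1 \<omega>)\<^sup>2) - (LINT \<omega>:A|M. W 1 \<omega> * area \<omega>) / 5
      + 6 / 5 * (LINT \<omega>:A|M. (area \<omega>)\<^sup>2) + prob A / 15"
proof -
  interpret pair_sigma_finite lborel M ..
  have [measurable]: "A \<in> sets M"
    unfolding A_def by measurable
  let ?w = "\<lambda>u \<omega>. indicator {0..1} u * (W (max 0 (min 1 u)) \<omega>)\<^sup>2"
  have int: "integrable (lborel \<Otimes>\<^sub>M M) (\<lambda>(u, \<omega>). indicator A \<omega> * ?w u \<omega>)"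
  proof (rule Bochner_Integration.integrable_bound[OF integrable_product_square])
    show "(\<lambda>(u, \<omega>). indicator A \<omega> * ?w u \<omega>) \<in> borel_measurable (lborel \<Otimes>\<^sub>M M)"
      using borel_measurable_integrable[OF integrable_product_square] unfolding split_beta by measurable
  qed (auto simp: indicator_def)
  have "(LINT \<omega>:A|M. LBINT u:{0..1}. (W u \<omega>)\<^sup>2) = (LINT \<omega>|M. LINT u|lborel. indicator A \<omega> * ?w u \<omega>)"
    by (simp add: path_square_integral_eq set_lebesgue_integral_def[of M])
  also have "\<dots> = (LINT u|lborel. LINT \<omega>|M. indicator A \<omega> * ?w u \<omega>)"
    by (rule Fubini_integral[OF int])
  also have "\<dots> = (LINT u|lborel. indicator {0..1} u *\<^sub>R
      ((endpoint_weight u)\<^sup>2 * (LINT \<omega>:A|M. (W 1 \<omega>)\<^sup>2)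
      + 2 * endpoint_weight u * area_weight u * (LINT \<omega>:A|M. W 1 \<omega> * area \<omega>)
      + (area_weight u)\<^sup>2 * (LINT \<omega>:A|M. (area \<omega>)\<^sup>2) + residual_variance u * prob A))"
  proof (rule integral_cong_AE)
    show "(\<lambda>u. LINT \<omega>|M. indicator A \<omega> * ?w u \<omega>) \<in> borel_measurable lborel"
      using borel_measurable_integrable[OF int] by measurable
    show "AE u in lborel. (LINT \<omega>|M. indicator A \<omega> * ?w u \<omega>) = indicator {0..1} u *\<^sub>R
      ((endpoint_weight u)\<^sup>2 * (LINT \<omega>:A|M. (W 1 \<omega>)\<^sup>2)
      + 2 * endpoint_weight u * area_weight u * (LINT \<omega>:A|M. W 1 \<omega> * area \<omega>)
      + (area_weight u)\<^sup>2 * (LINT \<omega>:A|M. (area \<omega>)\<^sup>2) + residual_variance u * prob A)"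
      using AE_lborel_singleton[of 0] AE_lborel_singleton[of 1]
    proof eventually_elim
      case (elim u)
      show ?case
      proof (cases "u \<in> {0..1}")
        case True
        with elim have "0 < u" "u < 1" by auto
        from set_integral_value_square[OF this B, folded A_def]
        show ?thesis
          using True by (simp add: set_lebesgue_integral_def[of M])
      qed simp
    qed
  qed (simp add: endpoint_weight_def area_weight_def residual_variance_def)
  also have "\<dots> = (LBINT u:{0..1}. (endpoint_weight u)\<^sup>2 * (LINT \<omega>:A|M. (W 1 \<omega>)\<^sup>2)
      + 2 * endpoint_weight u * area_weight u * (LINT \<omega>:A|M. W 1 \<omega> * area \<omega>)
      + (area_weight u)\<^sup>2 * (LINT \<omega>:A|M. (area \<omega>)\<^sup>2) + residual_variance u * prob A)"
    by (simp only: set_lebesgue_integral_def[of lborel])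
  finally show ?thesis
    unfolding weights_integral by simp
qed

text \<open>
  The right-hand side is a function of \<open>W 1\<close> and the area with the same integral as the left-hand
  side over every event generated by them, and this characterises the conditional expectation.
\<close>

lemma cond_exp_path_square_integral:
  "AE \<omega> in M. real_cond_exp M (sigma_gen2 M (W 1) area) (\<lambda>\<omega>. LBINT u:{0..1}. (W u \<omega>)\<^sup>2) \<omega>
    = 2 / 15 * (W 1 \<omega>)\<^sup>2 - W 1 \<omega> * area \<omega> / 5 + 6 / 5 * (area \<omega>)\<^sup>2 + 1 / 15"
proof -
  let ?F = "sigma_gen2 M (W 1) area"
  have sets_F: "sets ?F = {(\<lambda>\<omega>. (W 1 \<omega>, area \<omega>)) -` B \<inter> space M | B. B \<in> sets (borel \<Otimes>\<^sub>M borel)}"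
    unfolding sigma_gen2_def by (rule sets_vimage_algebra2) (auto simp: space_pair_measure)
  have pair: "(\<lambda>\<omega>. (W 1 \<omega>, area \<omega>)) \<in> M \<rightarrow>\<^sub>M borel \<Otimes>\<^sub>M borel"
    by measurable
  have "subalgebra M ?F"
    unfolding subalgebra_def sets_F using measurable_sets[OF pair] by (auto simp: sigma_gen2_def)
  then interpret finite_measure_subalgebra M ?F
    by unfold_locales
  have [measurable]: "(\<lambda>\<omega>. (W 1 \<omega>, area \<omega>)) \<in> ?F \<rightarrow>\<^sub>M borel \<Otimes>\<^sub>M borel"
    unfolding sigma_gen2_def by (rule measurable_vimage_algebra1) (auto simp: space_pair_measure)
  have [measurable]: "W 1 \<in> borel_measurable ?F" "area \<in> borel_measurable ?F"
    using measurable_compose[of "\<lambda>\<omega>. (W 1 \<omega>, area \<omega>)" ?F "borel \<Otimes>\<^sub>M borel" fst borel]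
      measurable_compose[of "\<lambda>\<omega>. (W 1 \<omega>, area \<omega>)" ?F "borel \<Otimes>\<^sub>M borel" snd borel] by simp_all
  note endpoint = integrable_endpoint_area_square
  show ?thesis
  proof (rule real_cond_exp_charact)
    fix A assume "A \<in> sets ?F"
    then obtain B where B: "B \<in> sets (borel \<Otimes>\<^sub>M borel)" and A: "A = (\<lambda>\<omega>. (W 1 \<omega>, area \<omega>)) -` B \<inter> space M"
      by (auto simp: sets_F)
    have A_sets: "A \<in> sets M"
      unfolding A by (rule measurable_sets[OF pair B])
    have set_int: "set_integrable M A f" if "integrable M f" for f :: "'a \<Rightarrow> real"
      unfolding set_integrable_def by (rule integrable_mult_indicator[OF A_sets that])
    have const: "(LINT \<omega>:A|M. 1) = prob A"
      unfolding set_lebesgue_integral_def using A_sets by simp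
    have "(LINT \<omega>:A|M. 2 / 15 * (W 1 \<omega>)\<^sup>2 - W 1 \<omega> * area \<omega> / 5 + 6 / 5 * (area \<omega>)\<^sup>2 + 1 / 15)
        = 2 / 15 * (LINT \<omega>:A|M. (W 1 \<omega>)\<^sup>2) - (LINT \<omega>:A|M. W 1 \<omega> * area \<omega>) / 5
          + 6 / 5 * (LINT \<omega>:A|M. (area \<omega>)\<^sup>2) + prob A / 15"
      by (simp add: set_integral_add set_integral_diff set_int endpoint const)
    then show "(LINT \<omega>:A|M. LBINT u:{0..1}. (W u \<omega>)\<^sup>2)
        = (LINT \<omega>:A|M. 2 / 15 * (W 1 \<omega>)\<^sup>2 - W 1 \<omega> * area \<omega> / 5 + 6 / 5 * (area \<omega>)\<^sup>2 + 1 / 15)"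
      using set_integral_path_square_integral[OF B] by (simp add: A)
  qed (use endpoint integrable_path_square_integral in auto)
qed

end

theorem theorem1p2:
  fixes M :: "'a measure" and W :: "real \<Rightarrow> 'a \<Rightarrow> real"
  assumes "brownian_motion_on M 1 W"
  defines "What \<equiv> \<lambda>\<omega>. quadratic_of_path (\<lambda>u. W u \<omega>)"
  shows "(\<forall>\<omega>\<in>space M. \<exists>!p. matches_path (\<lambda>u. W u \<omega>) p) \<and>
    (AE \<omega> in M.
      real_cond_exp M (sigma_gen2 M (W 1) (\<lambda>\<omega>. LBINT u:{0..1}. W u \<omega>))
        (\<lambda>\<omega>. LBINT u:{0..1}. (W u \<omega>)\<^sup>2) \<omega>
      = (LBINT u:{0..1}. (poly (What \<omega>) u)\<^sup>2) + 1 / 15)"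
proof
  interpret unit_brownian_motion M W
    unfolding unit_brownian_motion_def by (rule assms(1))
  show "\<forall>\<omega>\<in>space M. \<exists>!p. matches_path (\<lambda>u. W u \<omega>) p"
    by (simp add: matches_path_iff)
  have What: "poly (What \<omega>) u = endpoint_weight u * W 1 \<omega> + area_weight u * area \<omega>" for \<omega> u
    unfolding What_def quadratic_of_path_def matches_path_iff the_eq_trivial poly_matching_eq ..
  have "(LBINT u:{0..1}. (poly (What \<omega>) u)\<^sup>2)
      = 2 / 15 * (W 1 \<omega>)\<^sup>2 - W 1 \<omega> * area \<omega> / 5 + 6 / 5 * (area \<omega>)\<^sup>2" for \<omega>
    using weights_integral[of "(W 1 \<omega>)\<^sup>2" "W 1 \<omega> * area \<omega>" "(area \<omega>)\<^sup>2" 0]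
    by (simp add: What power2_sum power_mult_distrib ac_simps)
  then show "AE \<omega> in M.
      real_cond_exp M (sigma_gen2 M (W 1) (\<lambda>\<omega>. LBINT u:{0..1}. W u \<omega>))
        (\<lambda>\<omega>. LBINT u:{0..1}. (W u \<omega>)\<^sup>2) \<omega>
      = (LBINT u:{0..1}. (poly (What \<omega>) u)\<^sup>2) + 1 / 15"
    using cond_exp_path_square_integral by simp
qed

end
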